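(* Let $M$ be a smooth, compact $n$-dimensional manifold without boundary ($n\ge 3$), let $T<\infty$, and let $g(t)$, $t\in[0,T)$, be a Type I solution of the Ricci flow $\frac{\partial}{\partial t}g(t)=-2\,\mathrm{Ric}(g(t))$ on $M$. Let $C$ be a constant. Then there exists $\delta>0$ such that, if $|R|(g(\cdot,t))\le C$ on $M$ for all $t\in[0,T)$, then $\mathrm{vol}_{g(t)}(M)\ge\delta$ for all $t\in[0,T)$.
   Context: $R$ is the scalar curvature and $\mathrm{vol}_{g(t)}(M)$ the Riemannian volume of $(M,g(t))$. A Type I solution (Type I Ricci flow) on $[0,T)$ is one for which there is a constant $C'>0$ with $\max_M|\mathrm{Rm}(\cdot,t)|\,(T-t)\le C'$ for all $t\in[0,T)$, where $\mathrm{Rm}$ is the Riemann curvature tensor. *)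

theory Defs
  imports "HOL-Analysis.Analysis"
begin

section \<open>Smooth functions\<close>

text \<open>
  All derivatives are taken within \<open>S\<close>. Below, \<open>S\<close> is either open or of the form \<open>V \<times> {0..<T}\<close> with
  \<open>V\<close> open; in both cases derivatives within \<open>S\<close> are unique, and on \<open>V \<times> {0..<T}\<close> the notion is
  smoothness up to and including the initial time, with one-sided time derivatives there.
\<close>

fun times_diff_on ::
  "nat \<Rightarrow> 'v::real_normed_vector set \<Rightarrow> ('v \<Rightarrow> 'w::real_normed_vector) \<Rightarrow> bool" where
  "times_diff_on 0 S f \<longleftrightarrow> continuous_on S f"
| "times_diff_on (Suc k) S f \<longleftrightarrow>
     (\<forall>x\<in>S. f differentiable (at x within S)) \<and>
     (\<forall>v. times_diff_on k S (\<lambda>x. frechet_derivative f (at x within S) v))"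

definition smooth_on ::
  "'v::real_normed_vector set \<Rightarrow> ('v \<Rightarrow> 'w::real_normed_vector) \<Rightarrow> bool" where
  "smooth_on S f \<longleftrightarrow> (\<forall>k. times_diff_on k S f)"


section \<open>Closed smooth manifolds\<close>

text \<open>
  A chart is a pair of its domain and its coordinate map. The coordinate map is a total function,
  but only its values on the domain matter.
\<close>

type_synonym ('a, 'n) chart = "'a set \<times> ('a \<Rightarrow> real ^ 'n)"

definition chart_inv :: "('a, 'n::finite) chart \<Rightarrow> real ^ 'n \<Rightarrow> 'a" where
  "chart_inv c = inv_into (fst c) (snd c)"

definition is_chart :: "'a topology \<Rightarrow> ('a, 'n::finite) chart \<Rightarrow> bool" where
  "is_chart X c \<longleftrightarrow> openin X (fst c) \<and> open (snd c ` fst c) \<and>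
     homeomorphic_map (subtopology X (fst c)) (top_of_set (snd c ` fst c)) (snd c)"

definition transition ::
  "('a, 'n::finite) chart \<Rightarrow> ('a, 'n) chart \<Rightarrow> real ^ 'n \<Rightarrow> real ^ 'n" where
  "transition c d x = snd d (chart_inv c x)"

definition smooth_atlas :: "'a topology \<Rightarrow> ('a, 'n::finite) chart set \<Rightarrow> bool" where
  "smooth_atlas X A \<longleftrightarrow> (\<forall>c\<in>A. is_chart X c) \<and> (\<Union>c\<in>A. fst c) = topspace X \<and>
     (\<forall>c\<in>A. \<forall>d\<in>A. smooth_on (snd c ` (fst c \<inter> fst d)) (transition c d))"

text \<open>
  The charts are modelled on open subsets of Euclidean space, so there is no boundary. The atlas
  need not be maximal: any atlas of the smooth structure will do.
\<close>

definition closed_smooth_manifold :: "'a topology \<Rightarrow> ('a, 'n::finite) chart set \<Rightarrow> bool" where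
  "closed_smooth_manifold X A \<longleftrightarrow>
     topspace X \<noteq> {} \<and> compact_space X \<and> Hausdorff_space X \<and> second_countable X \<and> smooth_atlas X A"


section \<open>Tangent vectors and Riemannian metrics\<close>

text \<open>
  A tangent vector at \<open>p\<close> is the family of its coordinate vectors in all charts around \<open>p\<close>, which
  are related by the derivatives of the transition maps. Entries at charts that do not contain \<open>p\<close>
  are normalised to zero.
\<close>

type_synonym ('a, 'n) tangent = "('a, 'n) chart \<Rightarrow> real ^ 'n"

definition charts_at :: "('a, 'n::finite) chart set \<Rightarrow> 'a \<Rightarrow> ('a, 'n) chart set" where
  "charts_at A p = {c \<in> A. p \<in> fst c}"

definition tangent_space :: "('a, 'n::finite) chart set \<Rightarrow> 'a \<Rightarrow> ('a, 'n) tangent set" where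
  "tangent_space A p = {v.
     (\<forall>c\<in>charts_at A p. \<forall>d\<in>charts_at A p.
        v d = frechet_derivative (transition c d) (at (snd c p)) (v c)) \<and>
     (\<forall>d. d \<notin> charts_at A p \<longrightarrow> v d = 0)}"

definition coord_vector ::
  "('a, 'n::finite) chart set \<Rightarrow> ('a, 'n) chart \<Rightarrow> 'a \<Rightarrow> 'n \<Rightarrow> ('a, 'n) tangent" where
  "coord_vector A c p i = (\<lambda>d.
     if d \<in> charts_at A p
     then frechet_derivative (transition c d) (at (snd c p)) (axis i 1) else 0)"

type_synonym ('a, 'n) two_tensor = "'a \<Rightarrow> ('a, 'n) tangent \<Rightarrow> ('a, 'n) tangent \<Rightarrow> real"

definition coord_matrix ::
  "('a, 'n::finite) chart set \<Rightarrow> ('a, 'n) two_tensor \<Rightarrow> ('a, 'n) chart \<Rightarrow>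
   real ^ 'n \<Rightarrow> real ^ 'n ^ 'n" where
  "coord_matrix A h c x =
     (let p = chart_inv c x in \<chi> i j. h p (coord_vector A c p i) (coord_vector A c p j))"

definition riemannian_metric ::
  "'a topology \<Rightarrow> ('a, 'n::finite) chart set \<Rightarrow> ('a, 'n) two_tensor \<Rightarrow> bool" where
  "riemannian_metric X A h \<longleftrightarrow>
     (\<forall>p\<in>topspace X.
        (\<forall>u\<in>tangent_space A p. \<forall>v\<in>tangent_space A p. h p u v = h p v u) \<and>
        (\<forall>u\<in>tangent_space A p. \<forall>v\<in>tangent_space A p. \<forall>w\<in>tangent_space A p. \<forall>a b.
           h p (\<lambda>c. a *\<^sub>R u c + b *\<^sub>R v c) w = a * h p u w + b * h p v w) \<and>
        (\<forall>u\<in>tangent_space A p. u \<noteq> (\<lambda>c. 0) \<longrightarrow> h p u u > 0)) \<and>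
     (\<forall>c\<in>A. smooth_on (snd c ` fst c) (coord_matrix A h c))"


section \<open>Curvature in local coordinates\<close>

text \<open>
  In this section \<open>G\<close> is the matrix of a metric in a chart, as a function of the coordinates.
  The curvature convention is
  \<open>R(\<partial>\<^sub>i, \<partial>\<^sub>j) \<partial>\<^sub>k = \<nabla>\<^sub>i \<nabla>\<^sub>j \<partial>\<^sub>k - \<nabla>\<^sub>j \<nabla>\<^sub>i \<partial>\<^sub>k = (\<Sum>l. riem G i j k l x * \<partial>\<^sub>l)\<close>,
  and the Ricci tensor is the trace over \<open>i = l\<close>, so that round spheres have positive Ricci curvature.
\<close>

definition pdiff :: "'n::finite \<Rightarrow> (real ^ 'n \<Rightarrow> real) \<Rightarrow> real ^ 'n \<Rightarrow> real" where
  "pdiff i f x = frechet_derivative f (at x) (axis i 1)"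

definition christoffel ::
  "(real ^ 'n \<Rightarrow> real ^ 'n ^ 'n) \<Rightarrow> 'n::finite \<Rightarrow> 'n \<Rightarrow> 'n \<Rightarrow> real ^ 'n \<Rightarrow> real" where
  "christoffel G i j k x = 1 / 2 * (\<Sum>l\<in>UNIV. matrix_inv (G x) $ k $ l *
     (pdiff i (\<lambda>y. G y $ j $ l) x + pdiff j (\<lambda>y. G y $ i $ l) x - pdiff l (\<lambda>y. G y $ i $ j) x))"

definition riem ::
  "(real ^ 'n \<Rightarrow> real ^ 'n ^ 'n) \<Rightarrow> 'n::finite \<Rightarrow> 'n \<Rightarrow> 'n \<Rightarrow> 'n \<Rightarrow> real ^ 'n \<Rightarrow> real" where
  "riem G i j k l x =
     pdiff i (christoffel G j k l) x - pdiff j (christoffel G i k l) x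
     + (\<Sum>m\<in>UNIV. christoffel G j k m x * christoffel G i m l x
                - christoffel G i k m x * christoffel G j m l x)"

definition ricci :: "(real ^ 'n \<Rightarrow> real ^ 'n ^ 'n) \<Rightarrow> real ^ 'n \<Rightarrow> real ^ 'n::finite ^ 'n" where
  "ricci G x = (\<chi> j k. \<Sum>i\<in>UNIV. riem G i j k i x)"

definition scalar_curv :: "(real ^ 'n \<Rightarrow> real ^ 'n ^ 'n) \<Rightarrow> real ^ 'n::finite \<Rightarrow> real" where
  "scalar_curv G x = (\<Sum>j\<in>UNIV. \<Sum>k\<in>UNIV. matrix_inv (G x) $ j $ k * ricci G x $ j $ k)"

definition riem_norm :: "(real ^ 'n \<Rightarrow> real ^ 'n ^ 'n) \<Rightarrow> real ^ 'n::finite \<Rightarrow> real" where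
  "riem_norm G x = sqrt (\<Sum>i\<in>UNIV. \<Sum>j\<in>UNIV. \<Sum>k\<in>UNIV. \<Sum>l\<in>UNIV.
      \<Sum>a\<in>UNIV. \<Sum>b\<in>UNIV. \<Sum>c\<in>UNIV. \<Sum>d\<in>UNIV.
        matrix_inv (G x) $ i $ a * matrix_inv (G x) $ j $ b * matrix_inv (G x) $ k $ c * G x $ l $ d
        * riem G i j k l x * riem G a b c d x)"


section \<open>Riemannian volume\<close>

text \<open>
  The manifold is cut into countably many Borel pieces, each inside a chart domain, and
  \<open>sqrt (det G)\<close> is integrated over each piece in the coordinates of its chart. By the change of
  variables formula the result does not depend on the sequence of charts; the one chosen here
  depends on the atlas only, not on the metric. For a metric on a closed manifold the volume
  is finite; it takes values in the extended nonnegative reals because the integrals do.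
\<close>

definition covers :: "'a topology \<Rightarrow> ('a, 'n::finite) chart set \<Rightarrow> (nat \<Rightarrow> ('a, 'n) chart) \<Rightarrow> bool" where
  "covers X A e \<longleftrightarrow> range e \<subseteq> A \<and> (\<Union>k. fst (e k)) = topspace X"

lemma covers_exists:
  assumes "closed_smooth_manifold X A"
  shows "\<exists>e. covers X A e"
proof -
  have comp: "compactin X (topspace X)" and ne: "topspace X \<noteq> {}"
    and op: "\<And>U. U \<in> fst ` A \<Longrightarrow> openin X U" and un: "\<Union> (fst ` A) = topspace X"
    using assms
    by (auto simp: closed_smooth_manifold_def compact_space_def smooth_atlas_def is_chart_def)
  obtain F where F: "finite F" "F \<subseteq> fst ` A" "topspace X \<subseteq> \<Union> F"
    using comp op un unfolding compactin_def by (metis order_refl)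
  then obtain B where B: "finite B" "B \<subseteq> A" "F = fst ` B"
    by (meson finite_subset_image)
  have "B \<noteq> {}" using F B ne by auto
  then have r: "range (from_nat_into B) = B"
    using B(1) by (simp add: countable_finite)
  have "(\<Union>k. fst (from_nat_into B k)) = \<Union> F"
    using r B(3) by (metis image_image)
  moreover have "\<Union> F = topspace X" using F un by auto
  ultimately show ?thesis
    unfolding covers_def using r B(2) by (intro exI[of _ "from_nat_into B"]) auto
qed

definition riem_volume ::
  "'a topology \<Rightarrow> ('a, 'n::finite) chart set \<Rightarrow> ('a, 'n) two_tensor \<Rightarrow> ennreal" where
  "riem_volume X A h =
     (let e = (SOME e. covers X A e) in
      \<Sum>k. \<integral>\<^sup>+ x \<in> snd (e k) ` (fst (e k) - (\<Union>j<k. fst (e j))).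
             ennreal (sqrt (det (coord_matrix A h (e k) x))) \<partial>lborel)"


section \<open>Ricci flow\<close>

definition ricci_flow ::
  "'a topology \<Rightarrow> ('a, 'n::finite) chart set \<Rightarrow> real \<Rightarrow> (real \<Rightarrow> ('a, 'n) two_tensor) \<Rightarrow> bool" where
  "ricci_flow X A T g \<longleftrightarrow>
     (\<forall>t\<in>{0..<T}. riemannian_metric X A (g t)) \<and>
     (\<forall>c\<in>A. smooth_on ((snd c ` fst c) \<times> {0..<T}) (\<lambda>(x, t). coord_matrix A (g t) c x)) \<and>
     (\<forall>c\<in>A. \<forall>x\<in>snd c ` fst c. \<forall>t\<in>{0..<T}.
        ((\<lambda>s. coord_matrix A (g s) c x) has_vector_derivative
           - 2 *\<^sub>R ricci (coord_matrix A (g t) c) x) (at t within {0..<T}))"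

text \<open>
  The scalar curvature and the norm of the curvature tensor at a point are computed in any chart
  around it. They do not depend on the chart, so the bounds below range over all of them.
\<close>

definition scalar_curv_at ::
  "('a, 'n::finite) chart set \<Rightarrow> ('a, 'n) two_tensor \<Rightarrow> ('a, 'n) chart \<Rightarrow> 'a \<Rightarrow> real" where
  "scalar_curv_at A h c p = scalar_curv (coord_matrix A h c) (snd c p)"

definition riem_norm_at ::
  "('a, 'n::finite) chart set \<Rightarrow> ('a, 'n) two_tensor \<Rightarrow> ('a, 'n) chart \<Rightarrow> 'a \<Rightarrow> real" where
  "riem_norm_at A h c p = riem_norm (coord_matrix A h c) (snd c p)"

definition type_I ::
  "'a topology \<Rightarrow> ('a, 'n::finite) chart set \<Rightarrow> real \<Rightarrow> (real \<Rightarrow> ('a, 'n) two_tensor) \<Rightarrow> bool" where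
  "type_I X A T g \<longleftrightarrow> (\<exists>C'>0. \<forall>t\<in>{0..<T}. \<forall>p\<in>topspace X. \<forall>c\<in>charts_at A p.
     riem_norm_at A (g t) c p * (T - t) \<le> C')"

end

theory Submission
  imports Defs
begin

text \<open>
  Under the Ricci flow, Jacobi's formula and the symmetry of the inverse metric give
  \<open>\<partial>\<^sub>t det G = - 2 R det G\<close> in every chart. An upper bound \<open>R \<le> K\<close> with \<open>K \<ge> 0\<close> thus yields
  \<open>sqrt (det G\<^sub>t) \<ge> exp (- K T) sqrt (det G\<^sub>0)\<close> pointwise. The initial density is continuous and
  positive, so it has a positive lower bound on some coordinate ball, and this ball alone already
  carries a definite amount of volume.
\<close>

section \<open>Determinants\<close>

lemma continuous_on_det:
  fixes M :: "'a::topological_space \<Rightarrow> real ^ 'n::finite ^ 'n"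
  assumes "continuous_on S M"
  shows "continuous_on S (\<lambda>x. det (M x))"
  unfolding det_def
  by (intro continuous_on_sum continuous_on_mult continuous_on_const continuous_on_prod
      continuous_on_component assms)

lemma matrix_inv_right:
  fixes M :: "real ^ 'n::finite ^ 'n"
  assumes "invertible M"
  shows "M ** matrix_inv M = mat 1"
  using someI_ex[OF assms[unfolded invertible_def]] by (simp add: matrix_inv_def)

text \<open>The product rule is kept relative to a set \<open>S\<close> because the flow is
  differentiated within \<open>{0..<T}\<close>, where the derivative at time 0 is one-sided.\<close>

lemma has_field_derivative_prod_within:
  fixes f :: "'i \<Rightarrow> 'a::real_normed_field \<Rightarrow> 'a"
  assumes "\<And>i. i \<in> I \<Longrightarrow> (f i has_field_derivative f' i) (at x within S)"
  shows "((\<lambda>y. \<Prod>i\<in>I. f i y) has_field_derivative (\<Sum>i\<in>I. f' i * (\<Prod>j\<in>I - {i}. f j x)))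
    (at x within S)"
proof -
  have "(\<lambda>y. \<Sum>i\<in>I. f' i * y * (\<Prod>j\<in>I - {i}. f j x)) =
      (*) (\<Sum>i\<in>I. f' i * (\<Prod>j\<in>I - {i}. f j x))"
    by (simp add: fun_eq_iff sum_distrib_left sum_distrib_right mult_ac)
  then show ?thesis
    using has_derivative_prod[of I f "\<lambda>i. (*) (f' i)" x S] assms
    by (simp add: has_field_derivative_def)
qed

text \<open>Differentiate the Leibniz expansion term by term. A permutation other than the identity
  moves at least two indices, so after one factor has been differentiated an off-diagonal entry of
  the identity matrix remains and kills the term. The identity permutation contributes the
  trace.\<close>

lemma has_real_derivative_det_at_one:
  fixes K :: "real \<Rightarrow> real ^ 'n::finite ^ 'n"
  assumes K: "(K has_vector_derivative K') (at t within S)" and one: "K t = mat 1"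
  shows "((\<lambda>s. det (K s)) has_real_derivative trace K') (at t within S)"
proof -
  have ent: "((\<lambda>s. K s $ i $ j) has_real_derivative K' $ i $ j) (at t within S)" for i j
    unfolding has_real_derivative_iff_has_vector_derivative
    by (rule bounded_linear.has_vector_derivative[OF bounded_linear_vec_nth],
        rule bounded_linear.has_vector_derivative[OF bounded_linear_vec_nth], rule K)
  let ?P = "{p. p permutes (UNIV :: 'n set)}"
  let ?d = "\<lambda>p. of_int (sign p) * (\<Sum>i\<in>UNIV. K' $ i $ p i * (\<Prod>j\<in>UNIV - {i}. K t $ j $ p j))"
  have der: "((\<lambda>s. det (K s)) has_real_derivative (\<Sum>p\<in>?P. ?d p)) (at t within S)"
    unfolding det_def
    by (intro DERIV_sum DERIV_cmult has_field_derivative_prod_within ent)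
  have "?d p = 0" if p: "p \<in> ?P" "p \<noteq> id" for p
  proof -
    obtain j where j: "p j \<noteq> j" using p(2) by (auto simp: fun_eq_iff)
    \<comment> \<open>By injectivity \<open>p j\<close> is a second moved index; it supplies the
      zero factor when the differentiated row is \<open>j\<close> itself.\<close>
    have pj: "p (p j) \<noteq> p j"
      using j p(1) by (metis (mono_tags) mem_Collect_eq permutes_inj injD)
    have zero: "(\<Prod>j\<in>UNIV - {i}. K t $ j $ p j) = 0" for i
    proof (cases "i = j")
      case True
      then show ?thesis using j pj
        by (intro prod_zero) (auto intro!: bexI[of _ "p j"] simp: one mat_def)
    next
      case False
      then show ?thesis using j
        by (intro prod_zero) (auto intro!: bexI[of _ j] simp: one mat_def)
    qed
    show ?thesis by (simp only: zero mult_zero_right sum.neutral_const)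
  qed
  then have "(\<Sum>p\<in>?P. ?d p) = (\<Sum>p\<in>{id}. ?d p)"
    by (intro sum.mono_neutral_right) (auto simp: permutes_id finite_permutations)
  also have "\<dots> = trace K'"
    by (simp add: sign_id one mat_def trace_def)
  finally show ?thesis using der by simp
qed

text \<open>Jacobi's formula. Right multiplication by the constant matrix
  \<open>matrix_inv (G t)\<close> moves the curve to the identity at time \<open>t\<close>, where
  the previous lemma applies; multiplicativity of the determinant undoes the normalisation.\<close>

lemma has_real_derivative_det:
  fixes G :: "real \<Rightarrow> real ^ 'n::finite ^ 'n"
  assumes G: "(G has_vector_derivative G') (at t within S)" and inv: "invertible (G t)"
  shows "((\<lambda>s. det (G s)) has_real_derivative det (G t) * trace (G' ** matrix_inv (G t)))
    (at t within S)"
proof -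
  let ?H = "matrix_inv (G t)"
  have HG: "G t ** ?H = mat 1"
    using inv by (rule matrix_inv_right)
  have lin: "bounded_linear (\<lambda>M :: real ^ 'n ^ 'n. M ** ?H)"
    by (intro linear_conv_bounded_linear[THEN iffD1] linearI)
      (auto simp: vec_eq_iff matrix_matrix_mult_def sum.distrib sum_distrib_left algebra_simps)
  have "((\<lambda>s. det (G s ** ?H)) has_real_derivative trace (G' ** ?H)) (at t within S)"
    by (rule has_real_derivative_det_at_one)
      (simp_all add: HG bounded_linear.has_vector_derivative[OF lin G])
  then have "((\<lambda>s. det (G t) * det (G s ** ?H)) has_real_derivative
      det (G t) * trace (G' ** ?H)) (at t within S)"
    by (rule DERIV_cmult)
  moreover have "det (G t) * det (G s ** ?H) = det (G s)" for s
  proof -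
    have "det (G t) * det ?H = 1" using HG by (metis det_mul det_I)
    then show ?thesis by (simp add: det_mul mult.left_commute)
  qed
  ultimately show ?thesis by simp
qed

text \<open>The segment from the identity to \<open>M\<close> consists of matrices with positive
  quadratic form, hence with trivial kernel. The determinant starts at 1 and cannot vanish along it,
  whereas a nonpositive end value would force a zero by the intermediate value theorem.\<close>

lemma det_pos_if_positive_definite:
  fixes M :: "real ^ 'n::finite ^ 'n"
  assumes pos: "\<And>v. v \<noteq> 0 \<Longrightarrow> v \<bullet> (M *v v) > 0"
  shows "det M > 0"
proof (rule ccontr)
  assume "\<not> det M > 0"
  define F where "F s = (1 - s) *\<^sub>R mat 1 + s *\<^sub>R M" for s :: real
  have "continuous_on {0..1} (\<lambda>s. det (F s))"
    unfolding F_def by (intro continuous_on_det continuous_intros)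
  then obtain s where s: "0 \<le> s" "s \<le> 1" "det (F s) = 0"
    using IVT2'[of "\<lambda>s. det (F s)" 1 0 0] \<open>\<not> det M > 0\<close> by (auto simp: F_def)
  then obtain v where v: "v \<noteq> 0" "F s *v v = 0"
    by (metis invertible_det_nz invertible_left_inverse matrix_left_invertible_ker)
  have "0 = v \<bullet> (F s *v v)" by (simp add: v)
  also have "\<dots> = (1 - s) * (v \<bullet> v) + s * (v \<bullet> (M *v v))"
    by (simp add: F_def matrix_vector_mult_add_rdistrib scaleR_matrix_vector_assoc[symmetric]
        inner_add_right)
  also have "\<dots> > 0"
  \<comment> \<open>For \<open>s > 0\<close> the \<open>M\<close> term is strictly positive and the
    other is nonnegative, possibly zero at \<open>s = 1\<close>; at \<open>s = 0\<close> only
    \<open>v \<bullet> v\<close> remains.\<close>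
  proof (cases "s = 0")
    case False
    then have "s * (v \<bullet> (M *v v)) > 0" using pos[OF v(1)] s by simp
    moreover have "(1 - s) * (v \<bullet> v) \<ge> 0" using s by simp
    ultimately show ?thesis by linarith
  qed (use v in simp)
  finally show False by simp
qed

text \<open>Transposing \<open>M ** matrix_inv M = mat 1\<close> makes the transposed inverse a left
  inverse of \<open>M\<close>, and a left inverse equals a right inverse.\<close>

lemma matrix_inv_symmetric:
  fixes M :: "real ^ 'n::finite ^ 'n"
  assumes inv: "invertible M" and sym: "transpose M = M"
  shows "transpose (matrix_inv M) = matrix_inv M"
proof -
  have "transpose (matrix_inv M) ** M = mat 1"
    by (metis inv matrix_inv_right matrix_transpose_mul sym transpose_mat)
  then show ?thesis
    by (metis inv matrix_inv_right matrix_mul_assoc matrix_mul_lid matrix_mul_rid)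
qed

section \<open>Coordinate matrices of a metric\<close>

lemma chart_inv_mem:
  assumes "x \<in> snd c ` fst c"
  shows "chart_inv c x \<in> fst c" "snd c (chart_inv c x) = x"
  using assms by (auto simp: chart_inv_def inv_into_into f_inv_into_f)

lemma is_chart_inv:
  assumes "is_chart X c" "p \<in> fst c"
  shows "chart_inv c (snd c p) = p"
proof -
  have "fst c \<subseteq> topspace X" using assms by (auto simp: is_chart_def openin_subset)
  then have "inj_on (snd c) (fst c)"
    using assms homeomorphic_imp_injective_map
    by (fastforce simp: is_chart_def Int_absorb1)
  then show ?thesis using assms by (simp add: chart_inv_def)
qed

lemma open_chart_image:
  assumes "is_chart X c" "openin X U" "U \<subseteq> fst c"
  shows "open (snd c ` U)"
proof -
  have "openin (subtopology X (fst c)) U"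
    using assms(2,3) by (metis inf.absorb_iff1 openin_subtopology)
  then have "openin (top_of_set (snd c ` fst c)) (snd c ` U)"
    using assms(1) homeomorphic_imp_open_map unfolding is_chart_def open_map_def by blast
  then show ?thesis
    using assms(1) by (auto simp: is_chart_def openin_open_eq)
qed

text \<open>The atlas provides derivatives within the image of the overlap. That image is open, so
  they are the full derivatives that occur in \<open>tangent_space\<close>.\<close>

lemma transition_differentiable:
  assumes A: "smooth_atlas X A" and c: "c \<in> charts_at A p" and d: "d \<in> charts_at A p"
  shows "transition c d differentiable (at (snd c p))"
proof -
  let ?U = "snd c ` (fst c \<inter> fst d)"
  have ch: "is_chart X c" "is_chart X d" "c \<in> A" "d \<in> A" "p \<in> fst c" "p \<in> fst d"
    using A c d by (auto simp: smooth_atlas_def charts_at_def)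
  have op: "open ?U"
    using ch by (intro open_chart_image[of X]) (auto simp: is_chart_def)
  have "times_diff_on (Suc 0) ?U (transition c d)"
    using A ch unfolding smooth_atlas_def smooth_on_def by blast
  then have "transition c d differentiable (at (snd c p) within ?U)"
    using ch by auto
  then show ?thesis
    using at_within_open[OF _ op, of "snd c p"] ch by (metis IntI imageI)
qed

text \<open>The cocycle identity for derivatives of transition maps. The composite through
  \<open>d\<close> agrees with \<open>transition c e\<close> on the image of the overlap of
  \<open>c\<close> and \<open>d\<close>, an open neighbourhood of \<open>snd c p\<close>, which
  suffices for the chain rule.\<close>

lemma transition_chain:
  assumes A: "smooth_atlas X A" and c: "c \<in> charts_at A p" and d: "d \<in> charts_at A p"
    and e: "e \<in> charts_at A p"
  shows "frechet_derivative (transition c e) (at (snd c p)) v =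
    frechet_derivative (transition d e) (at (snd d p))
      (frechet_derivative (transition c d) (at (snd c p)) v)"
proof -
  let ?U = "snd c ` (fst c \<inter> fst d)"
  have ch: "is_chart X c" "is_chart X d" "p \<in> fst c" "p \<in> fst d"
    using A c d by (auto simp: smooth_atlas_def charts_at_def)
  have op: "open ?U"
    using ch by (intro open_chart_image[of X]) (auto simp: is_chart_def)
  have cd: "transition c d (snd c p) = snd d p"
    using ch by (simp add: transition_def is_chart_inv)
  have "(transition c d has_derivative frechet_derivative (transition c d) (at (snd c p)))
      (at (snd c p))"
    using transition_differentiable[OF A c d] frechet_derivative_works by blast
  moreover have "(transition d e has_derivative frechet_derivative (transition d e) (at (snd d p)))
      (at (transition c d (snd c p)))"
    unfolding cd using transition_differentiable[OF A d e] frechet_derivative_works by blast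
  ultimately have "(transition d e \<circ> transition c d has_derivative
      frechet_derivative (transition d e) (at (snd d p)) \<circ>
      frechet_derivative (transition c d) (at (snd c p))) (at (snd c p))"
    by (rule diff_chain_at)
  then have "(transition c e has_derivative
      frechet_derivative (transition d e) (at (snd d p)) \<circ>
      frechet_derivative (transition c d) (at (snd c p))) (at (snd c p))"
    by (rule has_derivative_transform_within_open[OF _ op])
      (use ch in \<open>auto simp: transition_def is_chart_inv\<close>)
  from frechet_derivative_at[OF this] show ?thesis by (metis comp_apply)
qed

lemma frechet_derivative_transition_self:
  assumes A: "smooth_atlas X A" and c: "c \<in> charts_at A p"
  shows "frechet_derivative (transition c c) (at (snd c p)) v = v"
proof -
  have ch: "is_chart X c" "p \<in> fst c"
    using A c by (auto simp: smooth_atlas_def charts_at_def)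
  have "((\<lambda>x. x) has_derivative (\<lambda>x. x)) (at (snd c p))" by simp
  then have "(transition c c has_derivative (\<lambda>x. x)) (at (snd c p))"
    by (rule has_derivative_transform_within_open[of _ _ _ _ "snd c ` fst c"])
      (use ch in \<open>auto simp: transition_def is_chart_inv is_chart_def\<close>)
  from frechet_derivative_at[OF this] show ?thesis by metis
qed

lemma coord_vector_self:
  assumes "smooth_atlas X A" "c \<in> charts_at A p"
  shows "coord_vector A c p i c = axis i 1"
  using assms by (simp add: coord_vector_def frechet_derivative_transition_self)

text \<open>Compatibility between two charts is the cocycle identity started from the fixed chart
  \<open>c\<close>.\<close>

lemma coord_vector_in_tangent_space:
  assumes "smooth_atlas X A" "c \<in> charts_at A p"
  shows "coord_vector A c p i \<in> tangent_space A p"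
  unfolding tangent_space_def
proof (intro CollectI conjI ballI allI impI)
  fix d e assume "d \<in> charts_at A p" "e \<in> charts_at A p"
  then show "coord_vector A c p i e =
      frechet_derivative (transition d e) (at (snd d p)) (coord_vector A c p i d)"
    unfolding coord_vector_def by (simp only: if_True) (rule transition_chain[OF assms])
qed (simp add: coord_vector_def)

lemma zero_in_tangent_space:
  assumes "smooth_atlas X A"
  shows "(\<lambda>d. 0) \<in> tangent_space A p"
proof -
  have "frechet_derivative (transition c d) (at (snd c p)) 0 = 0"
    if "c \<in> charts_at A p" "d \<in> charts_at A p" for c d
    using transition_differentiable[OF assms that] linear_frechet_derivative linear_0 by blast
  then show ?thesis by (simp add: tangent_space_def)
qed

text \<open>Derivatives of transition maps are linear, so the compatibility condition survives
  linear combinations.\<close>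

lemma lincomb_in_tangent_space:
  assumes A: "smooth_atlas X A" and u: "u \<in> tangent_space A p" and v: "v \<in> tangent_space A p"
  shows "(\<lambda>d. a *\<^sub>R u d + b *\<^sub>R v d) \<in> tangent_space A p"
proof -
  have lin: "frechet_derivative (transition c d) (at (snd c p)) (a *\<^sub>R x + b *\<^sub>R y) =
      a *\<^sub>R frechet_derivative (transition c d) (at (snd c p)) x +
      b *\<^sub>R frechet_derivative (transition c d) (at (snd c p)) y"
    if "c \<in> charts_at A p" "d \<in> charts_at A p" for c d x y
    using linear_frechet_derivative[OF transition_differentiable[OF A that]]
    by (simp add: linear_add linear_scale)
  show ?thesis
    unfolding tangent_space_def
  proof (intro CollectI conjI ballI allI impI)
    fix c d assume cd: "c \<in> charts_at A p" "d \<in> charts_at A p"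
    have "u d = frechet_derivative (transition c d) (at (snd c p)) (u c)"
      "v d = frechet_derivative (transition c d) (at (snd c p)) (v c)"
      using u v cd unfolding tangent_space_def by blast+
    then show "a *\<^sub>R u d + b *\<^sub>R v d =
        frechet_derivative (transition c d) (at (snd c p)) (a *\<^sub>R u c + b *\<^sub>R v c)"
      by (simp only: lin[OF cd])
  next
    fix d assume "d \<notin> charts_at A p"
    then have "u d = 0" "v d = 0" using u v unfolding tangent_space_def by blast+
    then show "a *\<^sub>R u d + b *\<^sub>R v d = 0" by simp
  qed
qed

text \<open>Linearity of the metric is available on tangent vectors only, so the induction carries
  membership of the partial sums along with the formula.\<close>

lemma metric_sum_left:
  fixes h :: "('a, 'n::finite) two_tensor"
  assumes A: "smooth_atlas X A" and h: "riemannian_metric X A h" and p: "p \<in> topspace X"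
    and u: "\<And>i. u i \<in> tangent_space A p" and w: "w \<in> tangent_space A p" and fin: "finite I"
  shows "(\<lambda>d. \<Sum>i\<in>I. a i *\<^sub>R u i d) \<in> tangent_space A p \<and>
    h p (\<lambda>d. \<Sum>i\<in>I. a i *\<^sub>R u i d) w = (\<Sum>i\<in>I. a i * h p (u i) w)"
  using fin
proof -
  have lin: "h p (\<lambda>c. a *\<^sub>R u c + b *\<^sub>R v c) w = a * h p u w + b * h p v w"
    if "u \<in> tangent_space A p" "v \<in> tangent_space A p" for u v a b
    using h p w that unfolding riemannian_metric_def by blast
  from fin show ?thesis
  proof induction
    case empty
    have "h p (\<lambda>d. 0) w = 0"
      using lin[OF zero_in_tangent_space[OF A] zero_in_tangent_space[OF A], of 0 0] by simp
    then show ?case by (simp add: zero_in_tangent_space[OF A])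
  next
    case (insert i I)
    then show ?case
      using lin[OF u, of "\<lambda>d. \<Sum>i\<in>I. a i *\<^sub>R u i d" "a i" i 1]
        lincomb_in_tangent_space[OF A u, of "\<lambda>d. \<Sum>i\<in>I. a i *\<^sub>R u i d" "a i" i 1]
      by simp
  qed
qed

context
  fixes X :: "'a topology" and A :: "('a, 'n::finite) chart set" and h :: "('a, 'n) two_tensor"
    and c :: "('a, 'n) chart" and x :: "real ^ 'n"
  assumes A: "smooth_atlas X A" and h: "riemannian_metric X A h"
    and c: "c \<in> A" and x: "x \<in> snd c ` fst c"
begin

private lemma point:
  shows "chart_inv c x \<in> topspace X" "c \<in> charts_at A (chart_inv c x)"
  using A c chart_inv_mem[OF x] by (auto simp: smooth_atlas_def charts_at_def)

lemma coord_matrix_symmetric: "transpose (coord_matrix A h c x) = coord_matrix A h c x"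
proof -
  have "h (chart_inv c x) u v = h (chart_inv c x) v u"
    if "u \<in> tangent_space A (chart_inv c x)" "v \<in> tangent_space A (chart_inv c x)" for u v
    using h point(1) that unfolding riemannian_metric_def by blast
  then show ?thesis
    using coord_vector_in_tangent_space[OF A point(2)]
    by (simp add: coord_matrix_def Let_def transpose_def vec_eq_iff)
qed

text \<open>The quadratic form at \<open>v\<close> is the metric evaluated on the tangent vector
  with components \<open>v\<close> in the coordinate frame of \<open>c\<close>.\<close>

lemma coord_matrix_positive_definite:
  assumes v: "v \<noteq> 0"
  shows "v \<bullet> (coord_matrix A h c x *v v) > 0"
proof -
  define p where "p = chart_inv c x"
  note pt = point[folded p_def]
  let ?E = "\<lambda>i. coord_vector A c p i"
  let ?V = "\<lambda>d. \<Sum>i\<in>UNIV. v $ i *\<^sub>R ?E i d"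
  have E: "?E i \<in> tangent_space A p" for i
    using coord_vector_in_tangent_space[OF A pt(2)] .
  have V: "?V \<in> tangent_space A p"
    using metric_sum_left[where u = ?E and a = "($) v" and I = UNIV, OF A h pt(1) E E] by simp
  have sym: "h p u w = h p w u" if "u \<in> tangent_space A p" "w \<in> tangent_space A p" for u w
    using h pt(1) that unfolding riemannian_metric_def by blast
  have left: "h p ?V w = (\<Sum>i\<in>UNIV. v $ i * h p (?E i) w)" if "w \<in> tangent_space A p" for w
    using metric_sum_left[where u = ?E and a = "($) v" and I = UNIV, OF A h pt(1) E that] by simp
  \<comment> \<open>The frame is the standard basis when read in \<open>c\<close> itself, so this
    entry recovers \<open>v\<close> and shows that the tangent vector is nonzero.\<close>
  have "?V c = v"
    by (simp add: coord_vector_self[OF A pt(2)] vec_eq_iff axis_def if_distrib cong: if_cong)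
  then have "?V \<noteq> (\<lambda>d. 0)" using v by metis
  then have "0 < h p ?V ?V"
    using h pt(1) V unfolding riemannian_metric_def by blast
  \<comment> \<open>Linearity is given in the first slot; symmetry brings the second argument there
    for its own expansion.\<close>
  also have "\<dots> = (\<Sum>i\<in>UNIV. v $ i * (\<Sum>j\<in>UNIV. v $ j * h p (?E j) (?E i)))"
    using left[OF V] sym[OF E V] left[OF E] by simp
  also have "\<dots> = v \<bullet> (coord_matrix A h c x *v v)"
    using sym[OF E E]
    by (simp add: inner_vec_def matrix_vector_mult_def coord_matrix_def Let_def p_def[symmetric]
        mult.commute)
  finally show ?thesis .
qed

lemma det_coord_matrix_pos: "det (coord_matrix A h c x) > 0"
  by (rule det_pos_if_positive_definite) (rule coord_matrix_positive_definite)

text \<open>The matrix product contracts with the inverse metric in the opposite index order from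
  \<open>scalar_curv\<close>; symmetry of the inverse reconciles the two.\<close>

lemma trace_ricci_eq_scalar_curv:
  "trace (ricci (coord_matrix A h c) x ** matrix_inv (coord_matrix A h c x)) =
    scalar_curv (coord_matrix A h c) x"
proof -
  let ?H = "matrix_inv (coord_matrix A h c x)"
  have sym: "transpose ?H = ?H"
  proof (rule matrix_inv_symmetric)
    show "invertible (coord_matrix A h c x)"
      using det_coord_matrix_pos by (simp add: invertible_det_nz)
  qed (rule coord_matrix_symmetric)
  have "?H $ k $ j = ?H $ j $ k" for j k
    by (subst sym[symmetric]) (simp add: transpose_def)
  then have "ricci (coord_matrix A h c) x $ j $ k * ?H $ k $ j =
      ?H $ j $ k * ricci (coord_matrix A h c) x $ j $ k" for j k
    by (metis mult.commute)
  then show ?thesis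
    by (simp only: trace_def matrix_matrix_mult_def scalar_curv_def vec_lambda_beta)
qed

end

section \<open>The volume density along the flow\<close>

text \<open>A Gronwall argument: with the integrating factor \<open>exp (2 * K * s)\<close> the
  derivative becomes \<open>2 * (K - R s) * E s\<close>, nonnegative because
  \<open>R \<le> K\<close> and \<open>D > 0\<close>.\<close>

lemma exp_growth_lower_bound:
  fixes D R :: "real \<Rightarrow> real"
  assumes der: "\<And>t. t \<in> {0..<T} \<Longrightarrow> (D has_real_derivative - 2 * R t * D t) (at t within {0..<T})"
    and pos: "\<And>t. t \<in> {0..<T} \<Longrightarrow> D t > 0" and R: "\<And>t. t \<in> {0..<T} \<Longrightarrow> R t \<le> K"
    and t: "t \<in> {0..<T}"
  shows "exp (- 2 * K * t) * D 0 \<le> D t"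
proof -
  define E where "E s = exp (2 * K * s) * D s" for s
  have E: "(E has_real_derivative 2 * (K - R s) * E s) (at s within {0..<T})"
    if "s \<in> {0..<T}" for s
    unfolding E_def using der[OF that]
    by (auto intro!: derivative_eq_intros simp: algebra_simps)
  have "E 0 \<le> E t"
  proof (rule DERIV_nonneg_imp_increasing_open[where f = E])
    show "0 \<le> t" using t by simp
    \<comment> \<open>Since the derivative at time 0 is one-sided, monotonicity is drawn from
      continuity on the closed interval and two-sided derivatives at interior times.\<close>
    have "(E has_real_derivative 2 * (K - R s) * E s) (at s within {0..t})" if "s \<in> {0..t}" for s
      by (rule DERIV_subset[OF E]) (use that t in auto)
    then show "continuous_on {0..t} E" by (rule DERIV_continuous_on)
    fix s assume s: "0 < s" "s < t"
    then have mem: "s \<in> {0<..<T}" "s \<in> {0..<T}" using t by auto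
    have "(E has_real_derivative 2 * (K - R s) * E s) (at s within {0<..<T})"
      by (rule DERIV_subset[OF E]) (use mem in auto)
    then have "DERIV E s :> 2 * (K - R s) * E s"
      using mem by (simp add: at_within_open[of s "{0<..<T}"])
    moreover have "2 * (K - R s) * E s \<ge> 0"
      using R[OF mem(2)] pos[OF mem(2)] by (simp add: E_def)
    ultimately show "\<exists>y. DERIV E s :> y \<and> y \<ge> 0" by blast
  qed
  then have "exp (- 2 * K * t) * E 0 \<le> exp (- 2 * K * t) * E t" by simp
  then show ?thesis by (simp add: E_def mult.assoc[symmetric] exp_add[symmetric])
qed

lemma sqrt_det_ricci_flow_lower_bound:
  fixes A :: "('a, 'n::finite) chart set"
  assumes A: "smooth_atlas X A" and flow: "ricci_flow X A T g"
    and c: "c \<in> A" and x: "x \<in> snd c ` fst c" and K: "K \<ge> 0"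
    and R: "\<And>t. t \<in> {0..<T} \<Longrightarrow> scalar_curv (coord_matrix A (g t) c) x \<le> K"
    and t: "t \<in> {0..<T}"
  shows "exp (- K * T) * sqrt (det (coord_matrix A (g 0) c x)) \<le>
    sqrt (det (coord_matrix A (g t) c x))"
proof -
  let ?G = "\<lambda>s. coord_matrix A (g s) c x"
  let ?R = "\<lambda>s. scalar_curv (coord_matrix A (g s) c) x"
  have met: "riemannian_metric X A (g s)" if "s \<in> {0..<T}" for s
    using flow that by (auto simp: ricci_flow_def)
  have pos: "det (?G s) > 0" if "s \<in> {0..<T}" for s
    using det_coord_matrix_pos[OF A met[OF that] c x] .
  have der: "((\<lambda>s. det (?G s)) has_real_derivative - 2 * ?R s * det (?G s)) (at s within {0..<T})"
    if s: "s \<in> {0..<T}" for s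
  proof -
    let ?Ric = "ricci (coord_matrix A (g s) c) x"
    have "(?G has_vector_derivative - 2 *\<^sub>R ?Ric) (at s within {0..<T})"
      using flow c x s by (auto simp: ricci_flow_def)
    from has_real_derivative_det[OF this] pos[OF s]
    have "((\<lambda>s. det (?G s)) has_real_derivative
        det (?G s) * trace ((- 2 *\<^sub>R ?Ric) ** matrix_inv (?G s))) (at s within {0..<T})"
      by (auto simp: invertible_det_nz)
    moreover have "trace ((- 2 *\<^sub>R ?Ric) ** matrix_inv (?G s)) = - 2 * ?R s"
      unfolding trace_ricci_eq_scalar_curv[OF A met[OF s] c x, symmetric]
      by (simp add: trace_def matrix_matrix_mult_def sum_distrib_left mult.assoc)
    ultimately show ?thesis by (simp add: mult.commute)
  qed
  \<comment> \<open>Here \<open>K \<ge> 0\<close> allows \<open>t\<close> to be replaced by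
    \<open>T\<close>, which makes the bound uniform in time.\<close>
  have "K * t \<le> K * T" using t K by (intro mult_left_mono) auto
  then have "exp (- 2 * K * T) * det (?G 0) \<le> exp (- 2 * K * t) * det (?G 0)"
    using pos[of 0] t by simp
  also have "\<dots> \<le> det (?G t)"
    by (rule exp_growth_lower_bound[where D = "\<lambda>s. det (?G s)" and R = ?R, OF der pos R t])
  also have "exp (- 2 * K * T) = (exp (- K * T))\<^sup>2"
    by (simp add: power2_eq_square exp_add[symmetric])
  finally have "sqrt ((exp (- K * T))\<^sup>2 * det (?G 0)) \<le> sqrt (det (?G t))" by simp
  then show ?thesis by (simp add: real_sqrt_mult)
qed

theorem corollary1p2:
  fixes X :: "'a topology" and A :: "('a, 'n::finite) chart set"
    and g :: "real \<Rightarrow> ('a, 'n) two_tensor" and T C :: real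
  assumes "CARD('n) \<ge> 3"
    and "closed_smooth_manifold X A"
    and "0 < T"
    and "ricci_flow X A T g"
    and "type_I X A T g"
  shows "\<exists>\<delta>::real. \<delta> > 0 \<and>
    ((\<forall>t\<in>{0..<T}. \<forall>p\<in>topspace X. \<forall>c\<in>charts_at A p. \<bar>scalar_curv_at A (g t) c p\<bar> \<le> C) \<longrightarrow>
     (\<forall>t\<in>{0..<T}. riem_volume X A (g t) \<ge> ennreal \<delta>))"
proof -
  have A: "smooth_atlas X A" and ne: "topspace X \<noteq> {}"
    using assms(2) by (auto simp: closed_smooth_manifold_def)
  \<comment> \<open>This is the very choice made in \<open>riem_volume\<close>. It does not involve
    the metric, so all times share the same pieces.\<close>
  define e where "e = (SOME e. covers X A e)"
  have e: "covers X A e"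
    unfolding e_def by (rule someI_ex[OF covers_exists[OF assms(2)]])
  \<comment> \<open>Chart domains may be empty; the first nonempty one contributes its whole image to the volume.\<close>
  have "\<exists>k. fst (e k) \<noteq> {}" using e ne unfolding covers_def by blast
  then obtain k where k: "fst (e k) \<noteq> {}" and least: "\<And>j. j < k \<Longrightarrow> fst (e j) = {}"
    using exists_least_iff[of "\<lambda>k. fst (e k) \<noteq> {}"] by auto
  define U where "U = snd (e k) ` fst (e k)"
  have c: "e k \<in> A" using e by (auto simp: covers_def)
  have U: "open U" "U \<noteq> {}"
    using A c k by (auto simp: U_def smooth_atlas_def is_chart_def)
  let ?f = "\<lambda>t x. sqrt (det (coord_matrix A (g t) (e k) x))"
  have vol: "riem_volume X A (g t) \<ge> (\<integral>\<^sup>+ x \<in> U. ennreal (?f t x) \<partial>lborel)" for t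
  proof -
    let ?s = "\<lambda>k. \<integral>\<^sup>+ x \<in> snd (e k) ` (fst (e k) - (\<Union>j<k. fst (e j))).
             ennreal (sqrt (det (coord_matrix A (g t) (e k) x))) \<partial>lborel"
    have "?s k \<le> (\<Sum>k. ?s k)"
      using sum_le_suminf[of ?s "{k}"] by simp
    then show ?thesis
      using least by (simp add: riem_volume_def e_def[symmetric] U_def)
  qed
  have met: "riemannian_metric X A (g 0)"
    using assms(3,4) by (auto simp: ricci_flow_def)
  have "times_diff_on 0 U (coord_matrix A (g 0) (e k))"
    using met c unfolding riemannian_metric_def smooth_on_def U_def by blast
  then have cont: "continuous_on U (?f 0)"
    by (auto intro!: continuous_intros continuous_on_det)
  obtain x0 where x0: "x0 \<in> U" using U by auto
  \<comment> \<open>Half the initial density at \<open>x0\<close>: the strict inequality persists on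
    a neighbourhood by continuity.\<close>
  define m where "m = ?f 0 x0 / 2"
  have m: "m > 0" "m < ?f 0 x0"
    using det_coord_matrix_pos[OF A met c x0[unfolded U_def]] by (auto simp: m_def)
  have "open (U \<inter> ?f 0 -` {m<..})"
    using cont U(1) by (rule continuous_open_preimage) simp
  then obtain r where r: "r > 0" "cball x0 r \<subseteq> U \<inter> ?f 0 -` {m<..}"
    using x0 m by (metis (no_types, lifting) IntI greaterThan_iff open_contains_cball vimageI)
  \<comment> \<open>Decay factor times lower bound of the initial density times Euclidean volume of
    the ball. The absolute value of \<open>C\<close> provides the nonnegative constant that the
    density estimate asks for, whatever the sign of \<open>C\<close>, and \<open>\<delta>\<close> is
    fixed before the curvature bound is assumed.\<close>
  define \<delta> where "\<delta> = exp (- \<bar>C\<bar> * T) * m * measure lborel (cball x0 r)"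
  have "measure lborel (cball x0 r) > 0"
    using r(1) by (simp add: content_cball_pos)
  then have "\<delta> > 0" using m by (simp add: \<delta>_def)
  moreover have "ennreal \<delta> \<le> riem_volume X A (g t)"
    if R: "\<forall>t\<in>{0..<T}. \<forall>p\<in>topspace X. \<forall>c\<in>charts_at A p. \<bar>scalar_curv_at A (g t) c p\<bar> \<le> C"
      and t: "t \<in> {0..<T}" for t
  proof -
    have curv: "scalar_curv (coord_matrix A (g s) (e k)) x \<le> \<bar>C\<bar>"
      if x: "x \<in> U" and s: "s \<in> {0..<T}" for x s
    proof -
      obtain p where p: "p \<in> fst (e k)" "x = snd (e k) p" using x by (auto simp: U_def)
      then have "p \<in> topspace X" "e k \<in> charts_at A p"
        using e c by (auto simp: covers_def charts_at_def)
      then have "\<bar>scalar_curv_at A (g s) (e k) p\<bar> \<le> C" using R s by blast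
      then show ?thesis by (simp add: scalar_curv_at_def p(2))
    qed
    have low: "exp (- \<bar>C\<bar> * T) * m \<le> ?f t x" if x: "x \<in> cball x0 r" for x
    proof -
      have xU: "x \<in> U" "m \<le> ?f 0 x" using x r(2) by auto
      have "exp (- \<bar>C\<bar> * T) * m \<le> exp (- \<bar>C\<bar> * T) * ?f 0 x"
        using xU by simp
      also have "\<dots> \<le> ?f t x"
        using sqrt_det_ricci_flow_lower_bound[OF A assms(4) c xU(1)[unfolded U_def] _ _ t]
          curv[OF xU(1)] by simp
      finally show ?thesis .
    qed
    \<comment> \<open>Finiteness of the measure of the ball turns the real product into an extended
      one, which is the integral of a constant over the ball.\<close>
    have "ennreal \<delta> = ennreal (exp (- \<bar>C\<bar> * T) * m) * emeasure lborel (cball x0 r)"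
      using m emeasure_lborel_cball_finite[of x0 r]
      by (simp add: \<delta>_def ennreal_mult emeasure_eq_ennreal_measure less_top)
    also have "\<dots> = (\<integral>\<^sup>+ x \<in> cball x0 r. ennreal (exp (- \<bar>C\<bar> * T) * m) \<partial>lborel)"
      by (simp add: nn_integral_cmult_indicator)
    also have "\<dots> \<le> (\<integral>\<^sup>+ x \<in> U. ennreal (?f t x) \<partial>lborel)"
      using r(2) low by (intro nn_integral_mono) (auto simp: indicator_def intro!: ennreal_leI)
    also have "\<dots> \<le> riem_volume X A (g t)" by (rule vol)
    finally show ?thesis .
  qed
  ultimately show ?thesis by blast
qed

end
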